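(* Let $d \ge 2$ be an integer and $p$ a prime, and let \[\mathcal{P}_0^+ := \bigl\{ \sigma p^e : \sigma \in \{\pm 1\},\ e \in \mathbb{Z},\ e\ge 0 \bigr\}.\] For $a\in \mathbb{Q}^*$ and $b\in \mathcal{P}_0^+$, let $\psi_{d,a,b}:\mathbb{P}^1 \to \mathbb{P}^1$ be the rational map \[ \psi_{d,a,b} (z) = \frac{z}{az^d+b}.\] Then every rational periodic cycle of $\psi_{d,a,b}$ has length at most $2$.
   Context: In homogeneous coordinates $\psi_{d,a,b}([X,Y]) = [XY^{d-1}, aX^d+bY^d]$. A rational periodic cycle of length $n$ is a set $\{z_1,\dots,z_n\}$ of $n$ distinct points of $\mathbb{P}^1(\mathbb{Q})$ with $\psi_{d,a,b}(z_i)=z_{i+1}$ for $1\le i<n$ and $\psi_{d,a,b}(z_n)=z_1$. *)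

theory Defs
  imports Complex_Main "HOL-Computational_Algebra.Primes"
begin

definition proj_rel :: "((rat \<times> rat) \<times> (rat \<times> rat)) set" where
  "proj_rel = {((X, Y), (X', Y')). (X, Y) \<noteq> (0, 0) \<and> (X', Y') \<noteq> (0, 0) \<and>
     (\<exists>c. c \<noteq> 0 \<and> X' = c * X \<and> Y' = c * Y)}"

definition P1Q :: "(rat \<times> rat) set set" where
  "P1Q = (UNIV - {(0, 0)}) // proj_rel"

definition hpoint :: "rat \<Rightarrow> rat \<Rightarrow> (rat \<times> rat) set" where
  "hpoint X Y = proj_rel `` {(X, Y)}"

text \<open>The union runs over all representatives of the point; it is a single class
  for \<open>d \<ge> 2\<close>, \<open>a \<noteq> 0\<close>, \<open>b \<noteq> 0\<close> (lemmas \<open>psi_hpoint\<close>, \<open>psi_nonzero\<close>).\<close>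

definition psi :: "nat \<Rightarrow> rat \<Rightarrow> rat \<Rightarrow> (rat \<times> rat) set \<Rightarrow> (rat \<times> rat) set" where
  "psi d a b P = (\<Union>(X, Y) \<in> P. hpoint (X * Y ^ (d - 1)) (a * X ^ d + b * Y ^ d))"

definition rational_periodic_cycle ::
    "nat \<Rightarrow> rat \<Rightarrow> rat \<Rightarrow> nat \<Rightarrow> (rat \<times> rat) set set \<Rightarrow> bool" where
  "rational_periodic_cycle d a b n C \<longleftrightarrow> n \<ge> 1 \<and>
     (\<exists>z :: nat \<Rightarrow> (rat \<times> rat) set.
        C = z ` {1..n} \<and> C \<subseteq> P1Q \<and> inj_on z {1..n} \<and>
        (\<forall>i\<in>{1..<n}. psi d a b (z i) = z (i + 1)) \<and> psi d a b (z n) = z 1)"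

definition P0plus :: "nat \<Rightarrow> rat set" where
  "P0plus p = {\<sigma> * of_nat p powi e | \<sigma> e. \<sigma> \<in> {1, -1} \<and> e \<ge> 0}"

lemma equiv_proj_rel: "equiv (UNIV - {(0, 0)}) proj_rel"
proof (rule equivI)
  show "refl_on (UNIV - {(0, 0)}) proj_rel"
    by (auto simp: refl_on_def proj_rel_def intro!: exI[of _ 1])
  show "proj_rel \<subseteq> (UNIV - {(0, 0)}) \<times> (UNIV - {(0, 0)})"
    by (auto simp: proj_rel_def)
  show "sym proj_rel"
  proof (rule symI)
    fix u v assume "(u, v) \<in> proj_rel"
    then obtain X Y c where uv: "u = (X, Y)" "v = (c * X, c * Y)" "(X, Y) \<noteq> (0, 0)" "c \<noteq> 0"
      by (auto simp: proj_rel_def)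
    then show "(v, u) \<in> proj_rel"
      by (auto simp: proj_rel_def intro!: exI[of _ "inverse c"])
  qed
  show "trans proj_rel"
  proof (rule transI)
    fix u v w assume "(u, v) \<in> proj_rel" "(v, w) \<in> proj_rel"
    then obtain X Y c e where "u = (X, Y)" "w = (e * (c * X), e * (c * Y))"
      "(X, Y) \<noteq> (0, 0)" "c \<noteq> 0" "e \<noteq> 0"
      by (auto simp: proj_rel_def)
    then show "(u, w) \<in> proj_rel"
      by (auto simp: proj_rel_def intro!: exI[of _ "e * c"])
  qed
qed

lemma hpoint_in_P1Q: "(X, Y) \<noteq> (0, 0) \<Longrightarrow> hpoint X Y \<in> P1Q"
  by (auto simp: hpoint_def P1Q_def intro: quotientI)

lemma hpoint_scale:
  assumes "c \<noteq> 0"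
  shows "hpoint (c * X) (c * Y) = hpoint X Y"
proof (cases "(X, Y) = (0, 0)")
  case False
  then have "((X, Y), (c * X, c * Y)) \<in> proj_rel"
    using assms by (auto simp: proj_rel_def)
  then show ?thesis
    unfolding hpoint_def using equiv_class_eq[OF equiv_proj_rel] by metis
qed auto

lemma psi_nonzero:
  fixes a b X Y :: rat
  assumes "d \<ge> 2" "a \<noteq> 0" "b \<noteq> 0" "(X, Y) \<noteq> (0, 0)"
  shows "(X * Y ^ (d - 1), a * X ^ d + b * Y ^ d) \<noteq> (0, 0)"
  using assms by (auto simp: zero_power)

lemma psi_hpoint:
  assumes "d \<ge> 2" "(X, Y) \<noteq> (0, 0)"
  shows "psi d a b (hpoint X Y) = hpoint (X * Y ^ (d - 1)) (a * X ^ d + b * Y ^ d)"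
proof -
  obtain m where d: "d = Suc m" using assms by (cases d) auto
  have step: "hpoint (c * X * (c * Y) ^ (d - 1)) (a * (c * X) ^ d + b * (c * Y) ^ d)
      = hpoint (X * Y ^ (d - 1)) (a * X ^ d + b * Y ^ d)" if "c \<noteq> 0" for c
  proof -
    have eqs: "c * X * (c * Y) ^ (d - 1) = c ^ d * (X * Y ^ (d - 1))"
      "a * (c * X) ^ d + b * (c * Y) ^ d = c ^ d * (a * X ^ d + b * Y ^ d)"
      by (simp_all add: d power_mult_distrib algebra_simps)
    have "c ^ d \<noteq> 0" using that by simp
    then show ?thesis unfolding eqs by (rule hpoint_scale)
  qed
  have mem: "(X', Y') \<in> hpoint X Y \<longleftrightarrow> (\<exists>c. c \<noteq> 0 \<and> X' = c * X \<and> Y' = c * Y)" for X' Y'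
    using assms(2) by (auto simp: hpoint_def proj_rel_def)
  have self: "(X, Y) \<in> hpoint X Y"
    unfolding mem by (rule exI[of _ 1]) simp
  have "hpoint (X' * Y' ^ (d - 1)) (a * X' ^ d + b * Y' ^ d)
      = hpoint (X * Y ^ (d - 1)) (a * X ^ d + b * Y ^ d)" if "(X', Y') \<in> hpoint X Y" for X' Y'
    using that step unfolding mem by auto
  then have "(case u of (X', Y') \<Rightarrow> hpoint (X' * Y' ^ (d - 1)) (a * X' ^ d + b * Y' ^ d))
      = hpoint (X * Y ^ (d - 1)) (a * X ^ d + b * Y ^ d)" if "u \<in> hpoint X Y" for u
    using that by (cases u) simp
  moreover have "hpoint X Y \<noteq> {}" using self by blast
  ultimately show ?thesis
    unfolding psi_def by (simp cong: SUP_cong)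
qed

lemma psi_affine:
  assumes "d \<ge> 2" "a * z ^ d + b \<noteq> 0"
  shows "psi d a b (hpoint z 1) = hpoint (z / (a * z ^ d + b)) 1"
  using psi_hpoint[OF assms(1), of z 1 a b] assms(2)
    hpoint_scale[of "a * z ^ d + b" "z / (a * z ^ d + b)" 1]
  by simp

end

theory Submission
  imports Defs "HOL-Computational_Algebra.Squarefree"
begin

text \<open>
  In the coordinate \<open>u = 1/z\<close> the map reads \<open>u' * u ^ (d - 1) = a + b * u ^ d\<close>, and neither
  \<open>0\<close> nor \<open>\<infinity>\<close> lies on a cycle of length at least 3. For each prime \<open>q\<close> not dividing \<open>b\<close>, the
  \<open>q\<close>-adic valuation is constant along a cycle: at a point of minimal valuation either the term
  \<open>b * u\<close> dominates and the valuation never changes again, or the valuation of every point is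
  exactly \<open>v(a) / d\<close>. Hence all the \<open>|u|\<close> on the cycle agree up to powers of \<open>p\<close>. If they are all
  equal, the cycle has at most two points; this includes the case \<open>b = \<plusminus>1\<close>. Otherwise the ratio
  \<open>R\<close> of the largest to the smallest is at least 2, as is \<open>\<beta> = |b|\<close>. Estimating \<open>|a|\<close> from below at
  the largest and from above at the smallest point gives \<open>(\<beta> - 1) * R ^ d \<le> \<beta> + R\<close>, which forces
  \<open>\<beta> = R = d = 2\<close> and equality in all estimates; then \<open>|u'| = |u|\<close> at the largest point, and
  \<open>u\<close> lies on a cycle of length at most 2 because the map is odd for even \<open>d\<close>.
\<close>

section \<open>Valuations on the rationals\<close>

text \<open>At \<open>0\<close> the value is \<open>0\<close> instead of infinity, so the rules
  below need nonvanishing hypotheses.\<close>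

definition rat_val :: "int \<Rightarrow> rat \<Rightarrow> int" where
  "rat_val q x = int (multiplicity q (fst (quotient_of x))) - int (multiplicity q (snd (quotient_of x)))"

text \<open>Cross-multiplying with the reduced fraction shows that any fraction may be used to
  compute the valuation, in particular one over a common denominator.\<close>

lemma rat_val_divide:
  assumes q: "prime q" and "m \<noteq> 0" "n \<noteq> 0"
  shows "rat_val q (of_int m / of_int n) = int (multiplicity q m) - int (multiplicity q n)"
proof -
  define x :: rat where "x = of_int m / of_int n"
  obtain k l where kl: "quotient_of x = (k, l)" by force
  have l: "l > 0" using quotient_of_denom_pos[OF kl] .
  have x: "x = of_int k / of_int l" using quotient_of_div[OF kl] .
  have k: "k \<noteq> 0" using x assms by (auto simp: x_def)
  have "(of_int (m * l) :: rat) = of_int (k * n)"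
    using x l assms by (simp add: x_def field_simps)
  then have "m * l = k * n" by (simp only: of_int_eq_iff)
  then have "multiplicity q (m * l) = multiplicity q (k * n)" by simp
  then have "multiplicity q m + multiplicity q l = multiplicity q k + multiplicity q n"
    using assms k l by (simp add: prime_elem_multiplicity_mult_distrib[OF prime_imp_prime_elem[OF q]])
  then show ?thesis unfolding rat_val_def x_def[symmetric] kl by simp
qed

lemma rat_common_denominator:
  fixes x y :: rat
  obtains m k n where "n \<noteq> 0" "x = of_int m / of_int n" "y = of_int k / of_int n"
proof -
  obtain m1 n1 where 1: "quotient_of x = (m1, n1)" by force
  obtain m2 n2 where 2: "quotient_of y = (m2, n2)" by force
  have n: "n1 > 0" "n2 > 0" using quotient_of_denom_pos 1 2 by blast+
  show thesis
    using that[of "n1 * n2" "m1 * n2" "m2 * n1"] n quotient_of_div[OF 1] quotient_of_div[OF 2]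
    by simp
qed

lemma rat_val_mult:
  assumes "prime q" "x \<noteq> 0" "y \<noteq> 0"
  shows "rat_val q (x * y) = rat_val q x + rat_val q y"
proof -
  obtain m k n where *: "n \<noteq> 0" "x = of_int m / of_int n" "y = of_int k / of_int n"
    by (rule rat_common_denominator)
  have nz: "m \<noteq> 0" "k \<noteq> 0" using * assms by auto
  have "x * y = of_int (m * k) / of_int (n * n)" using * by simp
  then show ?thesis
    using assms * nz rat_val_divide[OF assms(1), of "m * k" "n * n"]
    by (simp add: rat_val_divide prime_elem_multiplicity_mult_distrib[OF prime_imp_prime_elem[OF assms(1)]])
qed

lemma rat_val_1 [simp]: "rat_val q 1 = 0"
  by (simp add: rat_val_def)

lemma rat_val_minus [simp]: "rat_val q (- x) = rat_val q x"
  by (simp add: rat_val_def rat_uminus_code split: prod.splits)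

lemma rat_val_abs [simp]: "rat_val q \<bar>x\<bar> = rat_val q x"
  by (simp add: abs_if)

lemma rat_val_power:
  assumes "prime q" "x \<noteq> 0"
  shows "rat_val q (x ^ k) = int k * rat_val q x"
  using assms by (induction k) (simp_all add: rat_val_mult algebra_simps)

lemma rat_val_add_ge:
  assumes q: "prime q" and "x \<noteq> 0" "y \<noteq> 0" "x + y \<noteq> 0" "c \<le> rat_val q x" "c \<le> rat_val q y"
  shows "c \<le> rat_val q (x + y)"
proof -
  obtain m k n where *: "n \<noteq> 0" "x = of_int m / of_int n" "y = of_int k / of_int n"
    by (rule rat_common_denominator)
  have sum: "x + y = of_int (m + k) / of_int n" using * by (simp add: add_divide_distrib)
  have nz: "m \<noteq> 0" "k \<noteq> 0" "m + k \<noteq> 0" using * sum assms by auto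
  define e where "e = min (multiplicity q m) (multiplicity q k)"
  have "q ^ e dvd m" "q ^ e dvd k" by (auto intro!: multiplicity_dvd' simp: e_def)
  then have "q ^ e dvd m + k" by simp
  then have "e \<le> multiplicity q (m + k)"
    using nz q by (intro multiplicity_geI) auto
  then show ?thesis
    using assms(5,6) unfolding sum unfolding * using rat_val_divide[OF q] * nz
    by (auto simp: e_def min_def simp del: of_int_add split: if_splits)
qed

lemma rat_val_add_eq:
  assumes q: "prime q" and nz: "x \<noteq> 0" "y \<noteq> 0" and less: "rat_val q x < rat_val q y"
  shows "rat_val q (x + y) = rat_val q x"
proof -
  have s: "x + y \<noteq> 0"
  proof
    assume "x + y = 0"
    then have "y = - x" by simp
    then show False using less by simp
  qed
  have "rat_val q x \<le> rat_val q (x + y)"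
    using rat_val_add_ge[OF q nz s] less by simp
  moreover have "\<not> rat_val q x < rat_val q (x + y)"
  proof
    assume "rat_val q x < rat_val q (x + y)"
    \<comment> \<open>The ultrametric inequality is applied to \<open>x = (x + y) + (- y)\<close>,
      whose summands would both have valuation at least \<open>rat_val q x + 1\<close>.\<close>
    then have "rat_val q x + 1 \<le> rat_val q ((x + y) + (- y))"
      using rat_val_add_ge[OF q s, of "- y" "rat_val q x + 1"] less nz by simp
    then show False by simp
  qed
  ultimately show ?thesis by simp
qed

lemma rat_val_prime_power:
  assumes "prime p" "prime q" "q \<noteq> p"
  shows "rat_val q (of_int p ^ e) = 0"
proof -
  have "rat_val q (of_int p) = 0"
    using assms rat_val_divide[of q p 1] by (auto simp: prime_multiplicity_other)
  then show ?thesis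
    using assms by (simp add: rat_val_power)
qed

text \<open>In lowest terms only \<open>p\<close> can divide numerator or denominator. The numerator
  exceeds 1, so \<open>p\<close> divides it, and coprimality leaves 1 as the denominator.\<close>

lemma rat_ge_2_of_val:
  fixes x :: rat
  assumes p: "prime p" and val: "\<And>q. prime q \<Longrightarrow> q \<noteq> p \<Longrightarrow> rat_val q x = 0" and x: "x > 1"
  shows "x \<ge> 2" and "rat_val p x \<noteq> 0"
proof -
  obtain k l where kl: "quotient_of x = (k, l)" by force
  have l: "l > 0" using quotient_of_denom_pos[OF kl] .
  have xd: "x = of_int k / of_int l" using quotient_of_div[OF kl] .
  have cop: "coprime k l" using quotient_of_coprime[OF kl] .
  have "(of_int k :: rat) > of_int l" using x l by (simp add: xd field_simps)
  then have k: "k > l" by simp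
  have eq_p: "q = p" if q: "prime q" "q dvd k \<or> q dvd l" for q
  proof (rule ccontr)
    assume "q \<noteq> p"
    then have "multiplicity q k = multiplicity q l"
      using val[OF q(1)] by (simp add: rat_val_def kl)
    moreover have "multiplicity q k > 0 \<longleftrightarrow> q dvd k" "multiplicity q l > 0 \<longleftrightarrow> q dvd l"
      using q k l by (simp_all add: prime_multiplicity_gt_zero_iff[OF prime_imp_prime_elem])
    ultimately have "q dvd k" "q dvd l" using q(2) by metis+
    then show False using cop q(1) by (meson coprime_common_divisor not_prime_unit)
  qed
  have "\<bar>k\<bar> \<noteq> 1" using k l by simp
  then obtain q where "prime q" "q dvd k"
    using prime_divisor_exists[of k] k l by auto
  then have pk: "p dvd k" using eq_p by blast
  have "l = 1"
  proof (rule ccontr)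
    assume "l \<noteq> 1"
    then obtain r where "prime r" "r dvd l"
      using prime_divisor_exists[of l] l by auto
    then have "p dvd l" using eq_p by blast
    then show False using pk cop p by (meson coprime_common_divisor not_prime_unit)
  qed
  then show "x \<ge> 2" using k by (simp add: xd)
  have "multiplicity p k > 0" using pk p k l by (simp add: prime_multiplicity_gt_zero_iff[OF prime_imp_prime_elem])
  then show "rat_val p x \<noteq> 0" using \<open>l = 1\<close> by (simp add: rat_val_def kl)
qed

section \<open>Periodic orbits\<close>

lemma periodic_obtain_min:
  fixes f :: "nat \<Rightarrow> 'a :: linorder"
  assumes "n \<ge> 1" and per: "\<And>i. f (i + n) = f i"
  obtains j where "\<And>i. f j \<le> f i"
proof -
  have mod: "f (i mod n) = f i" for i
  proof -
    have "f (r + k * n) = f r" for r k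
      by (induction k) (simp, metis per add.assoc add.commute mult_Suc)
    from this[of "i mod n" "i div n"] show ?thesis by simp
  qed
  have ne: "finite (f ` {..<n})" "f ` {..<n} \<noteq> {}" using assms(1) by (auto simp: lessThan_empty_iff)
  obtain j where "f j = Min (f ` {..<n})" using Min_in[OF ne] by auto
  moreover have "Min (f ` {..<n}) \<le> f i" for i
  proof -
    have "f (i mod n) \<in> f ` {..<n}" using assms(1) by simp
    then show ?thesis using ne Min_le mod by metis
  qed
  ultimately show thesis using that by metis
qed

text \<open>Here \<open>f\<close> abstracts the valuations along the orbit and \<open>A\<close> that
  of \<open>a\<close>. Nothing is assumed when \<open>d * f i = A\<close>, where the two terms may
  cancel.\<close>

lemma periodic_valuation_const:
  fixes f :: "nat \<Rightarrow> int"
  assumes n: "n \<ge> 1" and per: "\<And>i. f (i + n) = f i" and d: "d \<ge> 2"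
    and lo: "\<And>i. d * f i < A \<Longrightarrow> f (Suc i) = f i"
    and hi: "\<And>i. d * f i > A \<Longrightarrow> f (Suc i) = A - (d - 1) * f i"
  shows "f i = f j"
proof -
  obtain m where m: "\<And>i. f m \<le> f i" using periodic_obtain_min[of n f] n per by blast
  have "f i = f m" for i
  proof (cases "d * f m < A")
    case True
    have const: "f (m + k) = f m" for k
      using True lo by (induction k) simp_all
    have per': "f (i + k * n) = f i" for k
      by (induction k) (simp, metis per add.assoc add.commute mult_Suc)
    \<comment> \<open>Adding \<open>m\<close> full periods moves \<open>i\<close> past
      \<open>m\<close>, into the range where \<open>f\<close> is already constant.\<close>
    have "m \<le> i + m * n" using n by (simp add: trans_le_add2)
    then show ?thesis using const[of "i + m * n - m"] per'[of m] by simp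
  next
    case False
    have ge: "A \<le> d * f k" for k
      using mult_left_mono[OF m[of k], of d] d False by linarith
    have "d * f k = A" for k
    proof (rule ccontr)
      assume "d * f k \<noteq> A"
      then have gt: "A < d * f k" using ge[of k] by simp
      \<comment> \<open>A value above the threshold \<open>A / d\<close> would send its successor
        below it, against minimality of \<open>f m\<close>.\<close>
      have "A \<le> d * (A - (d - 1) * f k)" using ge[of "Suc k"] hi[OF gt] by simp
      then have "(d - 1) * (d * f k) \<le> (d - 1) * A" by (simp add: algebra_simps)
      then show False using gt d by simp
    qed
    then show ?thesis using d by (metis mult_cancel_left not_numeral_le_zero)
  qed
  then show ?thesis by metis
qed

text \<open>Away from equality of valuations, the term of smaller valuation among \<open>a\<close>
  and \<open>b * u i ^ d\<close> determines that of the sum.\<close>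

lemma orbit_rat_val_const:
  fixes u :: "nat \<Rightarrow> rat"
  assumes n: "n \<ge> 1" and per: "\<And>i. u (i + n) = u i" and nz: "\<And>i. u i \<noteq> 0"
    and d: "d \<ge> 2" and a: "a \<noteq> 0" and b: "b \<noteq> 0"
    and step: "\<And>i. u (Suc i) * u i ^ (d - 1) = a + b * u i ^ d"
    and q: "prime q" and vb: "rat_val q b = 0"
  shows "rat_val q (u i) = rat_val q (u j)"
proof (rule periodic_valuation_const[where f = "\<lambda>i. rat_val q (u i)" and n = n and d = "int d"
      and A = "rat_val q a"])
  have bu: "rat_val q (b * u i ^ d) = int d * rat_val q (u i)" for i
    using q b nz vb by (simp add: rat_val_mult rat_val_power)
  have lhs: "rat_val q (u (Suc i) * u i ^ (d - 1)) = rat_val q (u (Suc i)) + (int d - 1) * rat_val q (u i)" for i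
    using q nz d by (simp add: rat_val_mult rat_val_power of_nat_diff)
  show "rat_val q (u (Suc i)) = rat_val q (u i)" if "int d * rat_val q (u i) < rat_val q a" for i
    using rat_val_add_eq[OF q, of "b * u i ^ d" a] that bu[of i] lhs[of i] a b nz step[of i]
    by (simp add: algebra_simps)
  show "rat_val q (u (Suc i)) = rat_val q a - (int d - 1) * rat_val q (u i)"
    if "int d * rat_val q (u i) > rat_val q a" for i
    using rat_val_add_eq[OF q, of a "b * u i ^ d"] that bu[of i] lhs[of i] a b nz step[of i]
    by (simp add: algebra_simps)
qed (use n per d in simp_all)

text \<open>The chain \<open>\<beta> + R \<le> (\<beta> - 1) * R^2 \<le> R * (\<beta> * R - \<rho>)
  \<le> R ^ (d - 1) * (\<beta> * R - \<rho>) \<le> \<beta> + R\<close> collapses to equalities; the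
  third gives \<open>d = 2\<close>, the second \<open>\<rho> = R\<close>.\<close>

lemma extremal_ratio:
  fixes R \<rho> \<beta> :: "'a :: linordered_field"
  assumes R: "R \<ge> 2" and \<beta>: "\<beta> \<ge> 2" and \<rho>: "\<rho> \<le> R" and d: "d \<ge> 2"
    and le: "R ^ (d - 1) * (\<beta> * R - \<rho>) \<le> \<beta> + R"
  shows "d = 2" and "\<rho> = R"
proof -
  \<comment> \<open>This factorization makes both summands visibly nonnegative for \<open>R\<close>
    and \<open>\<beta>\<close> at least 2.\<close>
  have "(\<beta> - 1) * R\<^sup>2 - (\<beta> + R) = (R\<^sup>2 - 1) * (\<beta> - 2) + (R - 2) * (R + 1)"
    by (simp add: algebra_simps power2_eq_square)
  moreover have "R\<^sup>2 \<ge> 1" using R by (simp add: one_le_power)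
  ultimately have lower: "\<beta> + R \<le> (\<beta> - 1) * R\<^sup>2"
    using R \<beta> mult_nonneg_nonneg[of "R\<^sup>2 - 1" "\<beta> - 2"] mult_nonneg_nonneg[of "R - 2" "R + 1"]
    by linarith
  have ge: "R * (\<beta> * R - \<rho>) \<ge> (\<beta> - 1) * R\<^sup>2"
    using mult_left_mono[OF \<rho>, of R] R by (simp add: algebra_simps power2_eq_square)
  have "R * (\<beta> * R - \<rho>) > 0" using ge lower R \<beta> by linarith
  then have pos: "\<beta> * R - \<rho> > 0" using R by (simp add: zero_less_mult_iff)
  have "R ^ 1 \<le> R ^ (d - 1)" using R d by (intro power_increasing) auto
  then have mid: "R * (\<beta> * R - \<rho>) \<le> R ^ (d - 1) * (\<beta> * R - \<rho>)"
    using pos by (intro mult_right_mono) auto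
  then have "R ^ (d - 1) * (\<beta> * R - \<rho>) = R * (\<beta> * R - \<rho>)"
    using ge lower le by linarith
  then have "R ^ (d - 1) = R ^ 1" using pos by simp
  then have "d - 1 = 1" using R by (subst (asm) power_inject_exp) auto
  then show "d = 2" by simp
  have "R * (\<beta> * R - \<rho>) = (\<beta> - 1) * R\<^sup>2" using mid ge lower le by linarith
  then have "R * (R - \<rho>) = 0" by (simp add: algebra_simps power2_eq_square)
  then show "\<rho> = R" using R by simp
qed

text \<open>One such index suffices: if \<open>n\<close> is the exact period, it forces
  \<open>n dvd 2\<close>.\<close>

lemma orbit_returns_in_two_steps:
  fixes u :: "nat \<Rightarrow> rat" and p :: nat
  assumes n: "n \<ge> 1" and per: "\<And>i. u (i + n) = u i" and nz: "\<And>i. u i \<noteq> 0"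
    and d: "d \<ge> 2" and a: "a \<noteq> 0" and p: "prime p" and b: "b \<in> P0plus p"
    and step: "\<And>i. u (Suc i) * u i ^ (d - 1) = a + b * u i ^ d"
  shows "\<exists>i. u (i + 2) = u i"
proof -
  have det: "u (Suc i) = u (Suc j)" if "u i = u j" for i j
  proof -
    have "u (Suc i) * u i ^ (d - 1) = u (Suc j) * u i ^ (d - 1)" using step[of i] step[of j] that by simp
    then show ?thesis using nz by simp
  qed
  have fixed: "u (i + 2) = u i" if "u (Suc i) = u i" for i
    using det[OF that] that by simp
  obtain M' where "\<And>i. - \<bar>u M'\<bar> \<le> - \<bar>u i\<bar>"
    using periodic_obtain_min[OF n, of "\<lambda>i. - \<bar>u i\<bar>"] per by auto
  then have M: "\<bar>u i\<bar> \<le> \<bar>u M'\<bar>" for i by simp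
  obtain m' where m: "\<And>i. \<bar>u m'\<bar> \<le> \<bar>u i\<bar>"
    using periodic_obtain_min[OF n, of "\<lambda>i. \<bar>u i\<bar>"] per by auto
  define R where "R = \<bar>u M'\<bar> / \<bar>u m'\<bar>"
  show ?thesis
  proof (cases "R = 1")
    case True
    then have "\<bar>u M'\<bar> = \<bar>u m'\<bar>" using nz by (simp add: R_def)
    then have eq: "\<bar>u i\<bar> = \<bar>u j\<bar>" for i j using M[of i] M[of j] m[of i] m[of j] by linarith
    show ?thesis
    proof (cases "u 1 = u 0 \<or> u 2 = u 1")
      case True
      then show ?thesis using fixed[of 0] fixed[of 1] by (auto simp: numeral_2_eq_2)
    next
      case False
      \<comment> \<open>Both steps change the sign, so together they restore it.\<close>
      then have "u 2 = u 0" using eq[of 0 1] eq[of 1 2] by (auto simp: abs_eq_iff)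
      then show ?thesis by (intro exI[of _ 0]) (simp add: numeral_2_eq_2)
    qed
  next
    case False
    have R1: "R > 1" using M[of m'] nz False by (simp add: R_def field_simps)
    obtain \<sigma> e where se: "b = \<sigma> * of_nat p powi e" "\<sigma> \<in> {1, -1}" "e \<ge> 0"
      using b by (auto simp: P0plus_def)
    have babs: "\<bar>b\<bar> = of_int (int p) ^ nat e"
      using se by (auto simp: abs_mult power_int_def)
    have b0: "b \<noteq> 0" using babs p by (auto simp: prime_gt_0_nat)
    have pi: "prime (int p)" using p by simp
    have vR: "rat_val q R = 0" if q: "prime q" "rat_val q b = 0" for q
    proof -
      have "rat_val q (u M') = rat_val q (u m')"
        by (rule orbit_rat_val_const[OF n per nz d a b0 step q])
      moreover have "rat_val q (R * \<bar>u m'\<bar>) = rat_val q R + rat_val q \<bar>u m'\<bar>"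
        using q nz R1 by (intro rat_val_mult) auto
      moreover have "R * \<bar>u m'\<bar> = \<bar>u M'\<bar>" using nz by (simp add: R_def)
      ultimately show ?thesis by simp
    qed
    have vq: "rat_val q R = 0" if "prime q" "q \<noteq> int p" for q
      using that vR rat_val_prime_power[OF pi that] babs rat_val_abs[of q b] by simp
    have R2: "R \<ge> 2" and vp: "rat_val (int p) R \<noteq> 0"
      using rat_ge_2_of_val[OF pi vq R1] by auto
    \<comment> \<open>If \<open>b\<close> were 1 or -1, constancy of valuations would hold at
      \<open>p\<close> as well, making \<open>R\<close> a unit there.\<close>
    have "nat e \<noteq> 0"
    proof
      assume "nat e = 0"
      then have "rat_val (int p) b = 0" using babs rat_val_abs[of "int p" b] by simp
      then show False using vR[OF pi] vp by simp
    qed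
    then have "int p ^ 1 \<le> int p ^ nat e"
      using prime_ge_2_nat[OF p] by (intro power_increasing) auto
    then have "2 \<le> int p ^ nat e" using prime_ge_2_int[OF pi] by (simp only: power_one_right)
    then have "(of_int 2 :: rat) \<le> of_int (int p ^ nat e)" by (simp only: of_int_le_iff)
    then have b2: "\<bar>b\<bar> \<ge> 2" using babs by simp
    define \<mu> where "\<mu> = \<bar>u m'\<bar>"
    define \<rho> where "\<rho> = \<bar>u (Suc M')\<bar> / \<mu>"
    have \<mu>: "\<mu> > 0" using nz by (simp add: \<mu>_def)
    have uM: "\<bar>u M'\<bar> = R * \<mu>" and uM': "\<bar>u (Suc M')\<bar> = \<rho> * \<mu>"
      using \<mu> by (simp_all add: R_def \<rho>_def \<mu>_def)
    have \<rho>R: "\<rho> \<le> R" using M[of "Suc M'"] \<mu> by (simp add: uM uM')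
    obtain k where k: "d = Suc k" "k \<ge> 1" using d by (cases d) auto
    \<comment> \<open>Solving the recurrence for \<open>a\<close> bounds \<open>|a|\<close> from
      below at the largest point and, further on, from above at the smallest.\<close>
    have "a = u (Suc M') * u M' ^ k - b * u M' ^ d" using step[of M'] k by simp
    then have "\<bar>a\<bar> \<ge> \<bar>b * u M' ^ d\<bar> - \<bar>u (Suc M') * u M' ^ k\<bar>" by linarith
    then have 1: "\<bar>a\<bar> \<ge> \<bar>b\<bar> * (R * \<mu>) ^ d - (\<rho> * \<mu>) * (R * \<mu>) ^ k"
      by (simp add: abs_mult power_abs uM uM')
    have "a = u (Suc m') * u m' ^ k - b * u m' ^ d" using step[of m'] k by simp
    then have "\<bar>a\<bar> \<le> \<bar>b * u m' ^ d\<bar> + \<bar>u (Suc m') * u m' ^ k\<bar>" by linarith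
    also have "\<dots> = \<bar>b\<bar> * \<mu> ^ d + \<bar>u (Suc m')\<bar> * \<mu> ^ k"
      by (simp add: abs_mult power_abs \<mu>_def)
    also have "\<dots> \<le> \<bar>b\<bar> * \<mu> ^ d + (R * \<mu>) * \<mu> ^ k"
      using M[of "Suc m'"] \<mu> by (simp add: uM)
    finally have "\<bar>b\<bar> * (R * \<mu>) ^ d - (\<rho> * \<mu>) * (R * \<mu>) ^ k \<le> \<bar>b\<bar> * \<mu> ^ d + (R * \<mu>) * \<mu> ^ k"
      using 1 by linarith
    then have "\<mu> ^ d * (R ^ k * (\<bar>b\<bar> * R - \<rho>)) \<le> \<mu> ^ d * (\<bar>b\<bar> + R)"
      by (simp add: k power_mult_distrib algebra_simps)
    then have "R ^ (d - 1) * (\<bar>b\<bar> * R - \<rho>) \<le> \<bar>b\<bar> + R" using \<mu> k by simp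
    note ext = extremal_ratio[OF R2 b2 \<rho>R d this]
    have "\<bar>u (Suc M')\<bar> = \<bar>u M'\<bar>" using ext uM uM' by simp
    then consider "u (Suc M') = u M'" | "u (Suc M') = - u M'" by (auto simp: abs_eq_iff)
    then have "u (M' + 2) = u M'"
    proof cases
      case 2
      \<comment> \<open>For \<open>d = 2\<close> the right side of the recurrence is the same at
        \<open>u M'\<close> and at its negative.\<close>
      have "u (Suc (Suc M')) * (- u M') = u (Suc M') * u M'"
        using step[of M'] step[of "Suc M'"] ext(1) 2 by simp
      then show ?thesis using 2 nz by simp
    qed (rule fixed)
    then show ?thesis ..
  qed
qed

section \<open>Cycles on the projective line\<close>

text \<open>Points \<open>hpoint 1 u\<close> form the chart \<open>u = 1/z\<close>; it misses only
  \<open>hpoint 0 1\<close>, the point \<open>z = 0\<close>.\<close>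

lemma hpoint_1_eq_iff:
  assumes "X \<noteq> 0"
  shows "hpoint X Y = hpoint 1 v \<longleftrightarrow> Y = v * X"
proof
  assume eq: "hpoint X Y = hpoint 1 v"
  have "(X, Y) \<in> hpoint X Y"
    using assms by (auto simp: hpoint_def proj_rel_def intro!: exI[of _ 1])
  then have "(X, Y) \<in> hpoint 1 v" by (simp add: eq)
  then show "Y = v * X" by (auto simp: hpoint_def proj_rel_def)
next
  assume "Y = v * X"
  then show "hpoint X Y = hpoint 1 v" using hpoint_scale[OF assms, of 1 v] by (simp add: mult.commute)
qed

lemma hpoint_0_eq: "Y \<noteq> 0 \<Longrightarrow> hpoint 0 Y = hpoint 0 1"
  using hpoint_scale[of Y 0 1] by simp

lemma P1Q_cases:
  assumes "P \<in> P1Q"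
  obtains "P = hpoint 0 1" | u where "P = hpoint 1 u"
proof -
  obtain X Y where P: "P = hpoint X Y" "(X, Y) \<noteq> (0, 0)"
    using assms by (auto simp: P1Q_def quotient_def hpoint_def)
  show thesis
  proof (cases "X = 0")
    case True
    then show ?thesis using P hpoint_0_eq[of Y] that(1) by simp
  next
    case False
    then have "P = hpoint 1 (Y / X)" using P hpoint_1_eq_iff[of X Y "Y / X"] by simp
    then show ?thesis by (rule that(2))
  qed
qed

theorem theorem1p5:
  fixes d p :: nat and a b :: rat
  assumes "d \<ge> 2" and "prime p" and "a \<noteq> 0" and "b \<in> P0plus p"
  shows "\<forall>n C. rational_periodic_cycle d a b n C \<longrightarrow> n \<le> 2"
proof (intro allI impI, rule ccontr)
  fix n C
  assume cyc: "rational_periodic_cycle d a b n C" and "\<not> n \<le> 2"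
  then have n: "n \<ge> 3" by simp
  obtain z where z: "C = z ` {1..n}" "C \<subseteq> P1Q" "inj_on z {1..n}"
    "\<forall>i\<in>{1..<n}. psi d a b (z i) = z (i + 1)" "psi d a b (z n) = z 1"
    using cyc unfolding rational_periodic_cycle_def by blast
  have mod_n: "i mod n < n" for i using n by simp
  \<comment> \<open>The cycle, indexed from 1, becomes an \<open>n\<close>-periodic sequence indexed
    from 0.\<close>
  define w where "w i = z (i mod n + 1)" for i
  have w_step: "psi d a b (w i) = w (Suc i)" for i
  proof (cases "Suc (i mod n) = n")
    case True
    then show ?thesis using z(5) by (simp add: w_def mod_Suc)
  next
    case False
    then have "i mod n + 1 \<in> {1..<n}" using mod_n[of i] by (simp only: atLeastLessThan_iff) linarith
    then show ?thesis using z(4) False by (simp add: w_def mod_Suc)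
  qed
  have w_eq: "w i = w j \<longleftrightarrow> i mod n = j mod n" for i j
  proof -
    have "i mod n + 1 \<in> {1..n}" "j mod n + 1 \<in> {1..n}"
      using mod_n[of i] mod_n[of j] by (simp_all only: atLeastAtMost_iff) linarith+
    then show ?thesis using inj_on_eq_iff[OF z(3)] by (simp add: w_def)
  qed
  have no_fix: "w (Suc i) \<noteq> w i" for i
    using n by (auto simp: w_eq mod_Suc split: if_splits)
  have b0: "b \<noteq> 0" using assms(2,4) by (auto simp: P0plus_def prime_gt_0_nat)
  \<comment> \<open>The point \<open>z = 0\<close> is fixed because \<open>b\<close> is nonzero, and
    a cycle of length at least 3 contains no fixed point.\<close>
  have not0: "w i \<noteq> hpoint 0 1" for i
  proof
    assume "w i = hpoint 0 1"
    moreover have "psi d a b (hpoint 0 1) = hpoint 0 1"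
      using psi_hpoint[OF assms(1), of 0 1 a b] assms(1) hpoint_0_eq[OF b0] by (simp add: zero_power)
    ultimately show False using w_step[of i] no_fix[of i] by simp
  qed
  have "w i \<in> P1Q" for i
  proof -
    have "i mod n + 1 \<in> {1..n}" using mod_n[of i] by (simp only: atLeastAtMost_iff) linarith
    then show ?thesis using z(1,2) unfolding w_def by blast
  qed
  then have "\<exists>u. w i = hpoint 1 u" for i
    using P1Q_cases not0 by metis
  then obtain u where u: "\<And>i. w i = hpoint 1 (u i)" by metis
  have psi_u: "hpoint (u i ^ (d - 1)) (a + b * u i ^ d) = hpoint 1 (u (Suc i))" for i
    using psi_hpoint[OF assms(1), of 1 "u i" a b] w_step[of i] by (simp add: u)
  \<comment> \<open>The value \<open>u i = 0\<close> is \<open>z = \<infinity>\<close>, which maps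
    to the excluded point \<open>z = 0\<close> because \<open>a\<close> is nonzero.\<close>
  have nz: "u i \<noteq> 0" for i
  proof
    assume "u i = 0"
    then have "hpoint 1 (u (Suc i)) = hpoint 0 1"
      using psi_u[of i] assms(1) hpoint_0_eq[OF assms(3)] by (simp add: zero_power)
    then show False using not0[of "Suc i"] u by simp
  qed
  have step: "u (Suc i) * u i ^ (d - 1) = a + b * u i ^ d" for i
    using psi_u[of i] nz hpoint_1_eq_iff by simp
  have u_eq: "u i = u j \<longleftrightarrow> i mod n = j mod n" for i j
    using w_eq[of i j] hpoint_1_eq_iff[of 1 "u i" "u j"] by (simp add: u)
  have "\<exists>i. u (i + 2) = u i"
    by (rule orbit_returns_in_two_steps[where n = n and u = u, OF _ _ nz assms(1,3,2,4) step])
      (use n u_eq in simp_all)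
  then obtain i where "(i + 2) mod n = i mod n" using u_eq by auto
  then have "n dvd (i + 2) - i" using mod_eq_dvd_iff_nat[of i "i + 2" n] by simp
  then have "n \<le> 2" by (simp add: dvd_imp_le)
  then show False using n by simp
qed

end
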